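(* Let $p,q\in\mathbb{Z}$ be two distinct primes with $\operatorname{ord}_p(q)=p-1$, and put $r=p-1$. Let $F_p=(\omega_p^{jm})_{j,m=0,\ldots,p-1}\in\mathbb{F}_{q^r}^{p\times p}$ be the Fourier matrix in characteristic $q$. If $$q>\max_{\substack{A,B\subseteq\{0,1,\ldots,p-1\}\\ \#A=\#B}}\left|\,m_{A,B}\cdot p-\frac{\prod_{i<j}(a_j-a_i)}{\prod_{i<j}(j-i)}\right|,$$ where for given $A,B$ with $\#A=\#B=k$ we write $A=\{a_1<\ldots<a_k\}$ and the products run over $1\le i<j\le k$, then all minors of $F_p$ are nonzero.
   Context: $\operatorname{ord}_p(q)$ is the multiplicative order of $q$ modulo $p$. Let $\overline{\Phi_p(X)}=\sum_{i=0}^{p-1}X^i\in\mathbb{F}_q[X]$; since $\operatorname{ord}_p(q)=p-1$ it is irreducible, $\mathbb{F}_{q^{r}}\cong\mathbb{F}_q[X]/\overline{\Phi_p(X)}$, and $\omega_p\in\mathbb{F}_{q^r}$ is the class of $X$, a primitive $p$-th root of unity. A minor is the determinant of a square submatrix given by a row index set and a column index set of equal nonzero cardinality. For $A=\{a_1<\ldots<a_k\}\subseteq\{0,1,\ldots,p-1\}$ with $k\geq 1$, the Schur polynomial is $$s_A(x_1,\ldots,x_k)=\frac{\det\left(x_j^{a_i}\right)_{i,j=1,\ldots,k}}{\prod_{1\le i<j\le k}(x_j-x_i)}\in\mathbb{Z}[x_1,\ldots,x_k].$$ Write $s_A=\sum_{\mu\in T}c_\mu x^\mu$ with $T\subset\mathbb{Z}_{\ge0}^k$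 a finite set of exponent vectors and $c_\mu$ the (nonnegative integer) coefficients. For $B=\{b_1<\ldots<b_k\}\subseteq\{0,1,\ldots,p-1\}$, let $\langle\mu,B\rangle=\sum_{j=1}^k\mu_jb_j$ and $$m_{A,B}=\sum_{\mu\in T,\; p\mid\langle\mu,B\rangle}c_\mu,$$ i.e. the number of exponents of $s_A$, counted with multiplicity, such that $p$ divides $\langle\mu,B\rangle$. *)

theory Defs
  imports
    "HOL-Number_Theory.Number_Theory"
    "HOL-Library.Poly_Mapping"
    "Jordan_Normal_Form.Determinant"
    "Jordan_Normal_Form.DL_Submatrix"
    "Berlekamp_Zassenhaus.Finite_Field"
begin

section \<open>The field extension generated by a primitive root of unity\<close>

text \<open>
  The two primes are the cardinalities of type arguments of class \<^class>\<open>prime_card\<close>: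
  \<open>p = CARD('p)\<close> and \<open>q = CARD('q)\<close>.  Thus \<open>'q mod_ring\<close> is the prime field with \<open>q\<close> elements.
\<close>

definition cyclo_poly :: "'p::prime_card itself \<Rightarrow> 'q::prime_card mod_ring poly"
  where "cyclo_poly _ = (\<Sum>i<CARD('p). monom 1 i)"

definition cyclo_cong ::
    "'p::prime_card itself \<Rightarrow> 'q::prime_card mod_ring poly \<Rightarrow> 'q mod_ring poly \<Rightarrow> bool"
  where "cyclo_cong P f g \<longleftrightarrow> cyclo_poly P dvd f - g"

lemma equivp_cyclo_cong: "equivp (cyclo_cong P)"
proof (rule equivpI)
  show "reflp (cyclo_cong P)"
    by (auto intro: reflpI simp: cyclo_cong_def)
  show "symp (cyclo_cong P)"
    by (auto intro!: sympI simp: cyclo_cong_def dvd_diff_commute)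
  show "transp (cyclo_cong P)"
  proof (rule transpI)
    fix f g h
    assume "cyclo_cong P f g" "cyclo_cong P g h"
    then have "cyclo_poly P dvd (f - g) + (g - h)"
      unfolding cyclo_cong_def by (rule dvd_add)
    then show "cyclo_cong P f h"
      by (simp add: cyclo_cong_def)
  qed
qed

text \<open>
  The quotient of \<open>'q mod_ring poly\<close> by the ideal generated by \<^const>\<open>cyclo_poly\<close>.  It is a field
  (with \<open>q ^ (p - 1)\<close> elements) only if \<open>q\<close> is a primitive root modulo \<open>p\<close>, so that the type
  is merely an instance of \<^class>\<open>comm_ring_1\<close>.
\<close>

quotient_type (overloaded) ('q, 'p) cyclo_ext =
    "'q::prime_card mod_ring poly" / "cyclo_cong TYPE('p::prime_card)"
  morphisms rep_cyclo_ext cyclo_class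
  by (rule equivp_cyclo_cong)

lemma not_cyclo_poly_dvd_1:
  "\<not> (cyclo_poly TYPE('p::prime_card) :: 'q::prime_card mod_ring poly) dvd 1"
proof
  let ?c = "cyclo_poly TYPE('p) :: 'q mod_ring poly"
  assume "?c dvd 1"
  then have "degree ?c = 0"
    by (rule poly_dvd_1[THEN iffD1, THEN conjunct1])
  moreover have "coeff ?c (CARD('p) - 1) = 1"
    by (simp add: cyclo_poly_def coeff_sum)
  moreover have "CARD('p) - 1 > 0"
    using prime_card[where 'a = 'p] prime_gt_1_nat by force
  ultimately show False
    by (simp add: coeff_eq_0)
qed

instantiation cyclo_ext :: (prime_card, prime_card) comm_ring_1
begin

lift_definition zero_cyclo_ext :: "('a, 'b) cyclo_ext" is 0 .

lift_definition one_cyclo_ext :: "('a, 'b) cyclo_ext" is 1 .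

lift_definition plus_cyclo_ext ::
    "('a, 'b) cyclo_ext \<Rightarrow> ('a, 'b) cyclo_ext \<Rightarrow> ('a, 'b) cyclo_ext" is "(+)"
proof -
  fix f f' g g' :: "'a mod_ring poly"
  assume "cyclo_cong TYPE('b) f f'" "cyclo_cong TYPE('b) g g'"
  then have "cyclo_poly TYPE('b) dvd (f - f') + (g - g')"
    unfolding cyclo_cong_def by (rule dvd_add)
  then show "cyclo_cong TYPE('b) (f + g) (f' + g')"
    by (simp add: cyclo_cong_def algebra_simps)
qed

lift_definition uminus_cyclo_ext :: "('a, 'b) cyclo_ext \<Rightarrow> ('a, 'b) cyclo_ext" is uminus
proof -
  fix f f' :: "'a mod_ring poly"
  assume "cyclo_cong TYPE('b) f f'"
  then have "cyclo_poly TYPE('b) dvd f' - f"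
    unfolding cyclo_cong_def by (rule dvd_diff_commute[THEN iffD1])
  then show "cyclo_cong TYPE('b) (- f) (- f')"
    by (simp add: cyclo_cong_def)
qed

lift_definition minus_cyclo_ext ::
    "('a, 'b) cyclo_ext \<Rightarrow> ('a, 'b) cyclo_ext \<Rightarrow> ('a, 'b) cyclo_ext" is "(-)"
proof -
  fix f f' g g' :: "'a mod_ring poly"
  assume "cyclo_cong TYPE('b) f f'" "cyclo_cong TYPE('b) g g'"
  then have "cyclo_poly TYPE('b) dvd (f - f') - (g - g')"
    unfolding cyclo_cong_def by (rule dvd_diff)
  then show "cyclo_cong TYPE('b) (f - g) (f' - g')"
    by (simp add: cyclo_cong_def algebra_simps)
qed

lift_definition times_cyclo_ext ::
    "('a, 'b) cyclo_ext \<Rightarrow> ('a, 'b) cyclo_ext \<Rightarrow> ('a, 'b) cyclo_ext" is "(*)"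
proof -
  fix f f' g g' :: "'a mod_ring poly"
  assume "cyclo_cong TYPE('b) f f'" "cyclo_cong TYPE('b) g g'"
  then have "cyclo_poly TYPE('b) dvd (f - f') * g + f' * (g - g')"
    unfolding cyclo_cong_def by (intro dvd_add dvd_mult dvd_mult2)
  then show "cyclo_cong TYPE('b) (f * g) (f' * g')"
    by (simp add: cyclo_cong_def algebra_simps)
qed

instance
proof
  show "(0::('a, 'b) cyclo_ext) \<noteq> 1"
    by transfer (simp only: cyclo_cong_def diff_0 dvd_minus_iff not_cyclo_poly_dvd_1 simp_thms)
qed (transfer; simp add: cyclo_cong_def algebra_simps)+

end

definition omega :: "('q::prime_card, 'p::prime_card) cyclo_ext"
  where "omega = cyclo_class (monom 1 1)"

definition fourier_mat :: "('q::prime_card, 'p::prime_card) cyclo_ext mat"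
  where "fourier_mat = mat CARD('p) CARD('p) (\<lambda>(j, m). omega ^ (j * m))"


section \<open>Schur polynomials\<close>

text \<open>
  Integer polynomials in the variables \<open>x\<^sub>0, x\<^sub>1, \<dots>\<close>, as finitely supported maps from exponent
  vectors to coefficients.  All indices of variables and of elements of a set start from \<open>0\<close>;
  \<open>pick A i\<close> is the element of \<open>A\<close> that has exactly \<open>i\<close> smaller elements in \<open>A\<close>.
\<close>

type_synonym int_mpoly = "(nat \<Rightarrow>\<^sub>0 nat) \<Rightarrow>\<^sub>0 int"

definition var :: "nat \<Rightarrow> int_mpoly"
  where "var j = Poly_Mapping.single (Poly_Mapping.single j 1) 1"

text \<open>
  The quotient of the alternant by the Vandermonde product.  It exists in the polynomial ring, and
  it is unique because that ring is an integral domain.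
\<close>

definition schur_poly :: "nat set \<Rightarrow> int_mpoly"
  where "schur_poly A =
    (THE s. s * (\<Prod>j<card A. \<Prod>i<j. var j - var i) =
      det (mat (card A) (card A) (\<lambda>(i, j). var j ^ pick A i)))"

definition mult_count :: "nat \<Rightarrow> nat set \<Rightarrow> nat set \<Rightarrow> int"
  where "mult_count p A B =
    (\<Sum>\<mu> | \<mu> \<in> Poly_Mapping.keys (schur_poly A) \<and>
        p dvd (\<Sum>j<card B. Poly_Mapping.lookup \<mu> j * pick B j).
      Poly_Mapping.lookup (schur_poly A) \<mu>)"

definition vandermonde_ratio :: "nat set \<Rightarrow> real"
  where "vandermonde_ratio A =
    (\<Prod>j<card A. \<Prod>i<j. real (pick A j) - real (pick A i)) /
    (\<Prod>j<card A. \<Prod>i<j. real j - real i)"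

end

theory Submission
  imports Defs
begin

text \<open>
  A minor with rows \<open>A\<close> and columns \<open>B\<close>, both of size \<open>k\<close>, is the alternant with exponents \<open>A\<close> at
  the points \<open>\<omega> ^ b\<close>, \<open>b \<in> B\<close>; hence it is the value of the Schur polynomial \<open>s\<^sub>A\<close> at these points times
  their Vandermonde product.  This product is a unit, because \<open>\<omega> ^ d - 1\<close> divides \<open>\<omega> - 1\<close>, and thereby
  \<open>p\<close>, if \<open>p\<close> does not divide \<open>d\<close> (\<open>omega_power_minus_1_unit\<close>).  So if the minor vanishes, then
  \<open>s\<^sub>A\<close> vanishes at the points.  The value there is \<open>\<Sum>\<^sub>t n\<^sub>t \<omega> ^ t\<close>, where \<open>n\<^sub>t\<close> is the number of exponents
  \<open>\<mu>\<close> of \<open>s\<^sub>A\<close>, with multiplicity, that satisfy \<open>\<langle>\<mu>, B\<rangle> \<equiv> t\<close> modulo \<open>p\<close>.  The only linear relations over the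
  prime field between the powers \<open>1, \<omega>, \<dots>, \<omega> ^ (p - 1)\<close> are the multiples of \<open>\<Sum>\<^sub>t \<omega> ^ t = 0\<close>
  (\<open>sum_omega_power_eq_0D\<close>), so that all \<open>n\<^sub>t\<close> are congruent to \<open>n\<^sub>0 = m\<^sub>A\<^sub>,\<^sub>B\<close> modulo \<open>q\<close>.  Summing over \<open>t\<close>
  shows that \<open>q\<close> divides \<open>m\<^sub>A\<^sub>,\<^sub>B p - D\<close>, where \<open>D = s\<^sub>A(1, \<dots>, 1)\<close> is the quotient of
  \<open>\<Prod>\<^bsub>i<j\<^esub> (a\<^sub>j - a\<^sub>i)\<close> by \<open>\<Prod>\<^bsub>i<j\<^esub> (j - i)\<close>.  By the bound on \<open>q\<close> this difference is \<open>0\<close>.  Then \<open>p\<close> divides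
  \<open>D\<close> and thus some \<open>a\<^sub>j - a\<^sub>i\<close>, which lies strictly between \<open>0\<close> and \<open>p\<close>: a contradiction.

  Two facts about \<open>s\<^sub>A\<close> enter: that the alternant is divisible by the Vandermonde product, and the value at
  \<open>(1, \<dots>, 1)\<close>, where this product vanishes.  Both come from the explicit formula
  \<open>s\<^sub>A = det (h\<^bsub>a\<^sub>i - m\<^esub>(x\<^sub>0, \<dots>, x\<^sub>m))\<close> with complete homogeneous polynomials (\<open>schur_poly_eq_det\<close>), which
  expresses Newton interpolation of the monomials \<open>X ^ a\<^sub>i\<close> as a matrix factorization of the alternant.
\<close>

section \<open>Alternants and Newton interpolation\<close>

text \<open>
  The divided difference of \<open>X ^ a\<close> at the nodes \<open>x 0, \<dots>, x m\<close>, that is, the complete homogeneous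
  symmetric polynomial of degree \<open>a - m\<close> in them.  The recursion comes from multiplying the Newton
  expansion of \<open>X ^ a\<close> by \<open>X = (X - x m) + x m\<close>; it avoids division by differences of nodes.
\<close>

fun newton_coeff :: "(nat \<Rightarrow> 'a::comm_ring_1) \<Rightarrow> nat \<Rightarrow> nat \<Rightarrow> 'a" where
  "newton_coeff x 0 m = (if m = 0 then 1 else 0)"
| "newton_coeff x (Suc a) m =
    x m * newton_coeff x a m + (case m of 0 \<Rightarrow> 0 | Suc l \<Rightarrow> newton_coeff x a l)"

lemma newton_coeff_eq_0: "a < m \<Longrightarrow> newton_coeff x a m = 0"
  by (induction a arbitrary: m) (auto split: nat.splits)

lemma newton_coeff_diag [simp]: "newton_coeff x a a = 1"
  by (induction a) (auto simp: newton_coeff_eq_0)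

lemma newton_coeff_1: "newton_coeff (\<lambda>_. 1) a m = of_nat (a choose m)"
  by (induction a arbitrary: m) (auto simp: binomial_eq_0 split: nat.splits)

text \<open>
  The full expansion has the terms \<open>m \<le> a\<close>.  Cutting it off at \<open>k\<close> loses nothing in two situations:
  if \<open>a < k\<close>, or if the Newton polynomial of index \<open>k\<close>, and with it every later one, vanishes at \<open>y\<close>, as
  it does when \<open>y\<close> is one of the first \<open>k\<close> nodes.  The second case is what makes the alternant a product of square matrices of size \<open>k\<close>.
\<close>

lemma newton_expansion:
  fixes x :: "nat \<Rightarrow> 'a::comm_ring_1"
  assumes "a < k \<or> (\<Prod>l<k. y - x l) = 0"
  shows "y ^ a = (\<Sum>m<k. newton_coeff x a m * (\<Prod>l<m. y - x l))"
  using assms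
proof (induction a)
  case 0
  then have "k \<noteq> 0"
    by (cases k) auto
  then show ?case
    by (cases k) (simp_all add: sum.lessThan_Suc_shift del: sum.lessThan_Suc)
next
  case (Suc a)
  let ?N = "\<lambda>m. \<Prod>l<m. y - x l"
  let ?c = "newton_coeff x a"
  obtain k' where k: "k = Suc k'"
    using Suc.prems by (cases k) auto
  \<comment> \<open>The factor \<open>y - x m\<close> shifts the index \<open>m\<close> by one; this is the term that leaves the range.\<close>
  have top: "?c k' * ?N (Suc k') = 0"
    using Suc.prems k by (auto simp: newton_coeff_eq_0)
  have IH: "y ^ a = (\<Sum>m<k. ?c m * ?N m)"
    using Suc by auto
  have "y ^ Suc a = (\<Sum>m<k. ?c m * ?N m * y)"
    by (simp add: IH sum_distrib_left mult_ac)
  also have "\<dots> = (\<Sum>m<k. x m * ?c m * ?N m) + (\<Sum>m<k. ?c m * ?N (Suc m))"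
    by (simp add: algebra_simps flip: sum.distrib)
  also have "(\<Sum>m<k. ?c m * ?N (Suc m)) = (\<Sum>m<k'. ?c m * ?N (Suc m))"
    using top by (simp add: k)
  also have "\<dots> = (\<Sum>m<k. (case m of 0 \<Rightarrow> 0 | Suc l \<Rightarrow> ?c l) * ?N m)"
    unfolding k by (subst sum.lessThan_Suc_shift) simp
  finally show ?case
    by (simp add: algebra_simps flip: sum.distrib)
qed

lemma det_mat_mult:
  fixes f g :: "nat \<Rightarrow> nat \<Rightarrow> 'a::comm_ring_1"
  shows "det (mat k k (\<lambda>(i, j). \<Sum>m<k. f i m * g m j)) =
    det (mat k k (\<lambda>(i, m). f i m)) * det (mat k k (\<lambda>(m, j). g m j))"
proof -
  have "mat k k (\<lambda>(i, j). \<Sum>m<k. f i m * g m j) =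
      mat k k (\<lambda>(i, m). f i m) * mat k k (\<lambda>(m, j). g m j)"
    by (rule eq_matI) (auto simp: scalar_prod_def atLeast0LessThan)
  then show ?thesis
    by (simp add: det_mult[of _ k])
qed

lemma det_mat_upper_triangular:
  assumes "\<And>i j. j < i \<Longrightarrow> f i j = 0"
  shows "det (mat k k (\<lambda>(i, j). f i j)) = (\<Prod>i<k. f i i)"
  by (subst det_upper_triangular[of _ k]) (auto simp: prod_list_diag_prod assms atLeast0LessThan)

lemma det_mat_lower_triangular:
  assumes "\<And>i j. i < j \<Longrightarrow> f i j = 0"
  shows "det (mat k k (\<lambda>(i, j). f i j)) = (\<Prod>i<k. f i i)"
  by (subst det_lower_triangular[of k]) (auto simp: prod_list_diag_prod assms atLeast0LessThan)

text \<open>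
  The columns of the second factor list the values of the Newton polynomials at \<open>x j\<close>.  It is upper
  triangular because the polynomial of index \<open>m\<close> vanishes at \<open>x 0, \<dots>, x (m - 1)\<close>, and its diagonal
  multiplies to the Vandermonde product.
\<close>

lemma det_alternant:
  fixes x :: "nat \<Rightarrow> 'a::comm_ring_1"
  shows "det (mat k k (\<lambda>(i, j). x j ^ a i)) =
    det (mat k k (\<lambda>(i, m). newton_coeff x (a i) m)) * (\<Prod>j<k. \<Prod>i<j. x j - x i)"
proof -
  have "(\<Prod>l<k. x j - x l) = 0" if "j < k" for j
    using that by (intro prod_zero) auto
  then have "mat k k (\<lambda>(i, j). x j ^ a i) =
      mat k k (\<lambda>(i, j). \<Sum>m<k. newton_coeff x (a i) m * (\<Prod>l<m. x j - x l))"
    by (intro eq_matI) (auto intro!: newton_expansion)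
  moreover have "det (mat k k (\<lambda>(m, j). \<Prod>l<m. x j - x l)) = (\<Prod>j<k. \<Prod>i<j. x j - x i)"
    by (subst det_mat_upper_triangular) (fastforce intro: prod_zero)+
  ultimately show ?thesis
    by (simp add: det_mat_mult)
qed

text \<open>
  The Newton polynomials are monic of degree \<open>m\<close>, so passing to them from the monomials is a unitriangular
  change of basis and leaves the Vandermonde determinant unchanged.
\<close>

lemma det_newton_basis:
  fixes x y :: "nat \<Rightarrow> 'a::comm_ring_1"
  shows "det (mat k k (\<lambda>(i, m). \<Prod>l<m. y i - x l)) = (\<Prod>j<k. \<Prod>i<j. y j - y i)"
proof -
  have unitriangular: "det (mat k k (\<lambda>(i, m). newton_coeff z i m)) = 1" for z :: "nat \<Rightarrow> 'a"
    by (subst det_mat_lower_triangular) (auto simp: newton_coeff_eq_0)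
  have "mat k k (\<lambda>(i, j). y j ^ i) =
      mat k k (\<lambda>(i, j). \<Sum>m<k. newton_coeff x i m * (\<Prod>l<m. y j - x l))"
    by (rule eq_matI) (auto intro!: newton_expansion)
  then have "det (mat k k (\<lambda>(i, j). y j ^ i)) = det (mat k k (\<lambda>(m, j). \<Prod>l<m. y j - x l))"
    by (simp add: det_mat_mult unitriangular)
  moreover have "det (mat k k (\<lambda>(i, j). y j ^ i)) = (\<Prod>j<k. \<Prod>i<j. y j - y i)"
    using det_alternant[of k y id] by (simp add: unitriangular)
  moreover have "mat k k (\<lambda>(i, m). \<Prod>l<m. y i - x l) =
      transpose_mat (mat k k (\<lambda>(m, j). \<Prod>l<m. y j - x l))"
    by (rule eq_matI) auto
  ultimately show ?thesis
    by (simp add: det_transpose[of _ k])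
qed

text \<open>
  At the nodes \<open>0, 1, 2, \<dots>\<close> the Newton polynomial of index \<open>m\<close> is \<open>m!\<close> times the binomial coefficient, and
  the factorials account for the Vandermonde product of \<open>0, \<dots>, k - 1\<close>.
\<close>

lemma det_binomial:
  fixes a :: "nat \<Rightarrow> nat"
  shows "det (mat k k (\<lambda>(i, m). int (a i choose m))) * (\<Prod>j<k. \<Prod>i<j. int j - int i) =
    (\<Prod>j<k. \<Prod>i<j. int (a j) - int (a i))"
proof -
  have fact: "(\<Prod>i<j. int j - int i) = fact j" for j
    using gbinomial_int_mult_fact[of j "int j"] by (simp add: atLeast0LessThan flip: int_binomial)
  let ?d = "\<lambda>m j. if m = j then fact j else 0 :: int"
  have "int (a i choose m) * fact m = (\<Prod>l<m. int (a i) - int l)" for i m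
    using gbinomial_int_mult_fact[of m "int (a i)"]
    by (simp add: atLeast0LessThan mult.commute flip: int_binomial)
  then have "mat k k (\<lambda>(i, j). \<Sum>m<k. int (a i choose m) * ?d m j) =
      mat k k (\<lambda>(i, j). \<Prod>l<j. int (a i) - int l)"
    by (intro eq_matI) (auto simp: if_distrib cong: if_cong)
  moreover have "det (mat k k (\<lambda>(m, j). ?d m j)) = (\<Prod>j<k. \<Prod>i<j. int j - int i)"
    by (subst det_mat_upper_triangular) (auto simp: fact)
  ultimately show ?thesis
    using det_mat_mult[of k "\<lambda>i m. int (a i choose m)" ?d]
      det_newton_basis[of k "\<lambda>i. int (a i)" int] by simp
qed

section \<open>Evaluation of integer polynomials\<close>

text \<open>
  The substitution is given by the images of the monomials rather than of the variables.  This allows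
  monomials to be sent directly to \<open>\<omega> ^ \<langle>\<mu>, B\<rangle>\<close>, with all variables outside the range of interest
  sent to \<open>1\<close>.
\<close>

definition mpoly_eval :: "((nat \<Rightarrow>\<^sub>0 nat) \<Rightarrow> 'a::comm_ring_1) \<Rightarrow> int_mpoly \<Rightarrow> 'a"
  where "mpoly_eval \<phi> s = (\<Sum>\<mu>\<in>Poly_Mapping.keys s. of_int (Poly_Mapping.lookup s \<mu>) * \<phi> \<mu>)"

lemma mpoly_eval_single: "mpoly_eval \<phi> (Poly_Mapping.single \<mu> c) = of_int c * \<phi> \<mu>"
  by (simp add: mpoly_eval_def)

lemma mpoly_eval_add: "mpoly_eval \<phi> (s + t) = mpoly_eval \<phi> s + mpoly_eval \<phi> t"
  unfolding mpoly_eval_def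
  by (rule setsum_keys_plus_distrib) (auto simp: algebra_simps)

lemma mpoly_eval_0: "mpoly_eval \<phi> 0 = 0"
  by (simp add: mpoly_eval_def)

lemma mpoly_eval_sum: "mpoly_eval \<phi> (\<Sum>i\<in>S. f i) = (\<Sum>i\<in>S. mpoly_eval \<phi> (f i))"
  by (induction S rule: infinite_finite_induct) (auto simp: mpoly_eval_0 mpoly_eval_add)

lemma sum_single_lookup:
  "(\<Sum>\<mu>\<in>Poly_Mapping.keys s. Poly_Mapping.single \<mu> (Poly_Mapping.lookup s \<mu>)) = s"
  by (rule poly_mapping_eqI)
    (auto simp: lookup_sum lookup_single when_def in_keys_iff)

lemma comm_ring_hom_mpoly_eval:
  assumes "\<phi> 0 = 1" and "\<And>\<mu> \<nu>. \<phi> (\<mu> + \<nu>) = \<phi> \<mu> * \<phi> \<nu>"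
  shows "comm_ring_hom (mpoly_eval \<phi>)"
proof
  fix s t :: int_mpoly
  have "s * t = (\<Sum>\<mu>\<in>Poly_Mapping.keys s. \<Sum>\<nu>\<in>Poly_Mapping.keys t.
      Poly_Mapping.single (\<mu> + \<nu>) (Poly_Mapping.lookup s \<mu> * Poly_Mapping.lookup t \<nu>))"
    by (subst (1 2) sum_single_lookup[symmetric]) (simp add: sum_product mult_single)
  then show "mpoly_eval \<phi> (s * t) = mpoly_eval \<phi> s * mpoly_eval \<phi> t"
    by (simp add: mpoly_eval_sum mpoly_eval_single assms(2))
      (simp add: mpoly_eval_def sum_product mult_ac)
  show "mpoly_eval \<phi> 1 = 1"
    using assms(1) by (simp add: mpoly_eval_single flip: single_one)
qed (simp_all add: mpoly_eval_0 mpoly_eval_add)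

lemma (in comm_ring_hom) hom_newton_coeff:
  "hom (newton_coeff x a m) = newton_coeff (\<lambda>j. hom (x j)) a m"
  by (induction a arbitrary: m) (auto simp: hom_distribs split: nat.splits)

text \<open>
  The alternant factorization in the polynomial ring itself, combined with cancellation of the
  Vandermonde product, which is nonzero since the variables are distinct.
\<close>

lemma schur_poly_eq_det:
  "schur_poly A =
    det (mat (card A) (card A) (\<lambda>(i, m). newton_coeff var (pick A i) m))" (is "_ = ?s")
proof -
  let ?V = "\<Prod>j<card A. \<Prod>i<j. var j - var i"
  have "var j \<noteq> var i" if "i < j" for i j
  proof
    assume "var j = var i"
    then have "Poly_Mapping.keys (var j) = Poly_Mapping.keys (var i)"
      by simp
    then have "Poly_Mapping.keys (Poly_Mapping.single j (1::nat)) =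
        Poly_Mapping.keys (Poly_Mapping.single i (1::nat))"
      by (simp add: var_def)
    then show False
      using that by simp
  qed
  then have V: "?V \<noteq> 0"
    by (force simp: prod_zero_iff)
  have s: "?s * ?V = det (mat (card A) (card A) (\<lambda>(i, j). var j ^ pick A i))"
    by (rule det_alternant[symmetric])
  show ?thesis
    unfolding schur_poly_def
  proof (rule the_equality)
    fix t
    assume "t * ?V = det (mat (card A) (card A) (\<lambda>(i, j). var j ^ pick A i))"
    then have "t * ?V = ?s * ?V"
      unfolding s .
    then show "t = ?s"
      unfolding mult_right_cancel[OF V] .
  qed (rule s)
qed

section \<open>The ring generated by a root of unity\<close>

lemma comm_ring_hom_cyclo_class:
  "comm_ring_hom (cyclo_class :: 'q::prime_card mod_ring poly \<Rightarrow> ('q, 'p::prime_card) cyclo_ext)"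
  by standard
    (simp_all add: zero_cyclo_ext.abs_eq one_cyclo_ext.abs_eq plus_cyclo_ext.abs_eq
      times_cyclo_ext.abs_eq)

interpretation cyclo_class: comm_ring_hom
  "cyclo_class :: 'q::prime_card mod_ring poly \<Rightarrow> ('q, 'p::prime_card) cyclo_ext"
  by (rule comm_ring_hom_cyclo_class)

lemma cyclo_class_eq_0_iff:
  "(cyclo_class f :: ('q::prime_card, 'p::prime_card) cyclo_ext) = 0 \<longleftrightarrow>
    cyclo_poly TYPE('p) dvd f"
proof -
  have "(cyclo_class f :: ('q, 'p) cyclo_ext) = cyclo_class 0 \<longleftrightarrow> cyclo_poly TYPE('p) dvd f"
    by (simp only: cyclo_ext.abs_eq_iff cyclo_cong_def diff_0_right)
  then show ?thesis
    by (simp only: cyclo_class.hom_zero)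
qed

lemma of_nat_card_cyclo_ext: "(of_nat CARD('q) :: ('q::prime_card, 'p::prime_card) cyclo_ext) = 0"
proof -
  have "(of_nat CARD('q) :: ('q, 'p) cyclo_ext) = cyclo_class (of_nat CARD('q))"
    by (simp only: cyclo_class.hom_of_nat)
  also have "(of_nat CARD('q) :: 'q mod_ring poly) = 0"
    by (simp only: of_nat_poly of_nat_card_eq_0 pCons_0_0)
  finally show ?thesis
    by simp
qed

lemma omega_power_eq: 
  "(omega :: ('q::prime_card, 'p::prime_card) cyclo_ext) ^ n = cyclo_class (monom 1 n)"
proof (induction n)
  case (Suc n)
  have "monom 1 (Suc n) = (monom 1 1 * monom 1 n :: 'q mod_ring poly)"
    by (simp add: mult_monom)
  then show ?case
    unfolding power_Suc Suc.IH by (simp only: omega_def cyclo_class.hom_mult)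
qed simp

lemma sum_omega_power: "(\<Sum>i<CARD('p). omega ^ i :: ('q::prime_card, 'p::prime_card) cyclo_ext) = 0"
proof -
  have "(\<Sum>i<CARD('p). omega ^ i) = (cyclo_class (cyclo_poly TYPE('p)) :: ('q, 'p) cyclo_ext)"
    by (simp add: omega_power_eq cyclo_poly_def cyclo_class.hom_sum)
  then show ?thesis
    by (simp add: cyclo_class_eq_0_iff)
qed

lemma omega_power_card: "(omega :: ('q::prime_card, 'p::prime_card) cyclo_ext) ^ CARD('p) = 1"
proof -
  have "(omega :: ('q, 'p) cyclo_ext) ^ CARD('p) - 1 = 0"
    by (simp only: power_diff_1_eq sum_omega_power mult_zero_right)
  then show ?thesis
    by (rule eq_iff_diff_eq_0[THEN iffD2])
qed

lemma omega_power_mod: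
  "(omega :: ('q::prime_card, 'p::prime_card) cyclo_ext) ^ (n mod CARD('p)) = omega ^ n"
proof -
  have "(omega :: ('q, 'p) cyclo_ext) ^ (CARD('p) * (n div CARD('p)) + n mod CARD('p)) =
      omega ^ (n mod CARD('p))"
    by (simp only: power_add power_mult omega_power_card power_one mult_1)
  then show ?thesis
    by (simp only: mult_div_mod_eq)
qed

text \<open>
  If \<open>d e \<equiv> 1\<close> modulo \<open>p\<close>, then \<open>\<omega> = (\<omega> ^ d) ^ e\<close>, so that \<open>\<omega> ^ d - 1\<close> divides \<open>\<omega> - 1\<close>.  Subtracting
  \<open>\<Sum>\<^sub>i \<omega> ^ i = 0\<close> from \<open>\<Sum>\<^sub>i 1 = p\<close> shows that \<open>\<omega> - 1\<close> divides \<open>p\<close>, which is invertible in characteristic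
  \<open>q \<noteq> p\<close>.
\<close>

lemma omega_power_minus_1_unit:
  assumes "CARD('p) \<noteq> CARD('q)" and "\<not> CARD('p) dvd d"
  shows "(omega ^ d - 1 :: ('q::prime_card, 'p::prime_card) cyclo_ext) dvd 1"
proof -
  let ?w = "omega :: ('q, 'p) cyclo_ext"
  have p: "prime CARD('p)" and q: "prime CARD('q)"
    by (rule prime_card)+
  have "coprime d CARD('p)"
    using p assms(2) by (metis coprime_commute prime_imp_coprime)
  then obtain e where "[d * e = 1] (mod CARD('p))"
    using cong_solve_coprime_nat by auto
  then have "?w ^ (d * e) = ?w"
    using p prime_gt_1_nat[OF p]
    by (metis cong_def omega_power_mod power_one_right)
  moreover have "?w ^ d - 1 dvd (?w ^ d) ^ e - 1"
    by (simp add: power_diff_1_eq)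
  ultimately have "?w ^ d - 1 dvd ?w - 1"
    by (simp add: power_mult)
  also have "?w - 1 dvd of_nat CARD('p)"
  proof -
    have "(\<Sum>i<CARD('p). ?w ^ i - 1) = - of_nat CARD('p)"
      by (simp add: sum_subtractf sum_omega_power)
    moreover have "?w - 1 dvd (\<Sum>i<CARD('p). ?w ^ i - 1)"
      by (intro dvd_sum) (simp add: power_diff_1_eq)
    ultimately show ?thesis
      by simp
  qed
  also have "of_nat CARD('p) dvd (1 :: ('q, 'p) cyclo_ext)"
  proof -
    have "coprime CARD('p) CARD('q)"
      using p q assms(1) primes_coprime by blast
    then have "coprime (int CARD('p)) (int CARD('q))"
      by simp
    then obtain u v where uv: "u * int CARD('p) + v * int CARD('q) = 1"
      by (metis bezout_int coprime_iff_gcd_eq_1)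
    have "of_int (u * int CARD('p) + v * int CARD('q)) = of_nat CARD('p) * (of_int u :: ('q, 'p) cyclo_ext)"
      by (simp add: of_nat_card_cyclo_ext)
    then show ?thesis
      unfolding uv by (metis dvd_triv_left of_int_1)
  qed
  finally show ?thesis .
qed

text \<open>
  A vanishing sum is a polynomial of degree below \<open>p\<close> divisible by \<open>1 + X + \<dots> + X ^ (p - 1)\<close>, hence a
  constant multiple of it.
\<close>

lemma sum_omega_power_eq_0D:
  fixes c :: "nat \<Rightarrow> int"
  assumes "(\<Sum>t<CARD('p). of_int (c t) * omega ^ t :: ('q::prime_card, 'p::prime_card) cyclo_ext) = 0"
    and "t < CARD('p)"
  shows "(of_int (c t) :: 'q mod_ring) = of_int (c 0)"
proof -
  let ?c = "\<lambda>t. of_int (c t) :: 'q mod_ring"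
  let ?f = "\<Sum>t<CARD('p). monom (?c t) t"
  let ?\<Phi> = "cyclo_poly TYPE('p) :: 'q mod_ring poly"
  have "(of_int (c t) * omega ^ t :: ('q, 'p) cyclo_ext) = cyclo_class (monom (?c t) t)" for t
  proof -
    have "monom (?c t) t = of_int (c t) * monom 1 t"
      by (simp add: of_int_poly smult_monom)
    then show ?thesis
      by (simp add: omega_power_eq cyclo_class.hom_mult cyclo_class.hom_of_int)
  qed
  then have "(cyclo_class ?f :: ('q, 'p) cyclo_ext) = 0"
    using assms(1) by (simp add: cyclo_class.hom_sum)
  then obtain g where g: "?f = ?\<Phi> * g"
    unfolding cyclo_class_eq_0_iff by (rule dvdE)
  have coeff_\<Phi>: "coeff ?\<Phi> t = (if t < CARD('p) then 1 else 0)" for t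
    by (simp add: cyclo_poly_def coeff_sum)
  have coeff_f: "coeff ?f t = (if t < CARD('p) then ?c t else 0)" for t
    by (simp add: coeff_sum)
  have "degree g = 0"
  proof (cases "g = 0")
    case False
    have "?\<Phi> \<noteq> 0"
      using not_cyclo_poly_dvd_1[where 'p = 'p and 'q = 'q] coeff_\<Phi>[of 0] by auto
    then have "degree ?f = degree ?\<Phi> + degree g"
      using False by (simp add: g degree_mult_eq)
    moreover have "degree ?f \<le> CARD('p) - 1"
      by (rule degree_le) (auto simp: coeff_f)
    moreover have "degree ?\<Phi> \<ge> CARD('p) - 1"
      by (rule le_degree) (simp add: coeff_\<Phi>)
    ultimately show ?thesis
      by simp
  qed simp
  then obtain b where "g = [:b:]"
    by (rule degree_eq_zeroE)
  then have "coeff ?f t = b" if "t < CARD('p)" for t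
    unfolding g using that by (simp add: coeff_\<Phi>)
  then show ?thesis
    using assms(2) by (simp add: coeff_f split: if_splits)
qed

lemma of_int_mod_ring_eq_iff:
  "(of_int a :: 'q::prime_card mod_ring) = of_int b \<longleftrightarrow> int CARD('q) dvd a - b"
proof -
  have "(of_int a :: 'q mod_ring) = of_int b \<longleftrightarrow> [a = b] (mod int CARD('q))"
    using of_int_eq_iff_cong_CHAR[where 'a = "'q mod_ring"] unfolding semiring_char_mod_ring .
  then show ?thesis
    unfolding cong_iff_dvd_diff .
qed

section \<open>Minors of the Fourier matrix\<close>

text \<open>
  The defining quotient of the Schur polynomial is \<open>0 / 0\<close> at \<open>(1, \<dots>, 1)\<close>; the determinant formula still
  makes sense there, since its entries become binomial coefficients.
\<close>

lemma schur_poly_at_1: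
  "(\<Sum>\<mu>\<in>Poly_Mapping.keys (schur_poly A). Poly_Mapping.lookup (schur_poly A) \<mu>) *
    (\<Prod>j<card A. \<Prod>i<j. int j - int i) =
    (\<Prod>j<card A. \<Prod>i<j. int (pick A j) - int (pick A i))"
proof -
  let ?ev = "mpoly_eval (\<lambda>_. 1) :: int_mpoly \<Rightarrow> int" and ?k = "card A"
  have hom: "comm_ring_hom ?ev"
    by (rule comm_ring_hom_mpoly_eval) simp_all
  have "?ev (var j) = 1" for j
    by (simp add: var_def mpoly_eval_single)
  then have "map_mat ?ev (mat ?k ?k (\<lambda>(i, m). newton_coeff var (pick A i) m)) =
      mat ?k ?k (\<lambda>(i, m). int (pick A i choose m))"
    by (intro eq_matI) (simp_all add: comm_ring_hom.hom_newton_coeff[OF hom] newton_coeff_1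
        del: newton_coeff.simps)
  then have "?ev (schur_poly A) = det (mat ?k ?k (\<lambda>(i, m). int (pick A i choose m)))"
    by (simp add: schur_poly_eq_det flip: comm_ring_hom.hom_det[OF hom])
  then show ?thesis
    using det_binomial[of ?k "pick A"] by (simp add: mpoly_eval_def)
qed

text \<open>
  The determinant formula for the Schur polynomial is transported along the evaluation, after which the
  alternant is factorized in the target ring.
\<close>

lemma alternant_eq_schur_poly_eval:
  fixes x :: "nat \<Rightarrow> 'a::comm_ring_1"
  assumes "\<phi> 0 = 1" and "\<And>\<mu> \<nu>. \<phi> (\<mu> + \<nu>) = \<phi> \<mu> * \<phi> \<nu>"
    and "\<And>j. j < card A \<Longrightarrow> \<phi> (Poly_Mapping.single j 1) = x j"
  shows "det (mat (card A) (card A) (\<lambda>(i, j). x j ^ pick A i)) =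
    mpoly_eval \<phi> (schur_poly A) * (\<Prod>j<card A. \<Prod>i<j. x j - x i)"
proof -
  have hom: "comm_ring_hom (mpoly_eval \<phi>)"
    using assms(1,2) by (rule comm_ring_hom_mpoly_eval)
  let ?k = "card A"
  define y where "y = (\<lambda>j. mpoly_eval \<phi> (var j))"
  have y: "y j = x j" if "j < ?k" for j
    using assms(3)[OF that] by (simp add: y_def var_def mpoly_eval_single)
  have "map_mat (mpoly_eval \<phi>) (mat ?k ?k (\<lambda>(i, m). newton_coeff var (pick A i) m)) =
      mat ?k ?k (\<lambda>(i, m). newton_coeff y (pick A i) m)"
    unfolding y_def by (rule eq_matI) (auto simp: comm_ring_hom.hom_newton_coeff[OF hom])
  then have schur: "mpoly_eval \<phi> (schur_poly A) =
      det (mat ?k ?k (\<lambda>(i, m). newton_coeff y (pick A i) m))"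
    unfolding schur_poly_eq_det comm_ring_hom.hom_det[OF hom, symmetric] by (rule arg_cong)
  have "mat ?k ?k (\<lambda>(i, j). x j ^ pick A i) = mat ?k ?k (\<lambda>(i, j). y j ^ pick A i)"
    by (rule eq_matI) (auto simp: y)
  then have "det (mat ?k ?k (\<lambda>(i, j). x j ^ pick A i)) =
      det (mat ?k ?k (\<lambda>(i, j). y j ^ pick A i))"
    by (rule arg_cong)
  also have "\<dots> = mpoly_eval \<phi> (schur_poly A) * (\<Prod>j<?k. \<Prod>i<j. y j - y i)"
    unfolding schur by (rule det_alternant)
  also have "(\<Prod>j<?k. \<Prod>i<j. y j - y i) = (\<Prod>j<?k. \<Prod>i<j. x j - x i)"
    by (intro prod.cong refl) (simp add: y)
  finally show ?thesis .
qed

text \<open>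
  The sum on the right is the value of the Schur polynomial at \<open>(1, \<dots>, 1)\<close>, which is the total of the
  numbers \<open>n t\<close> of exponents in the \<open>p\<close> residue classes; vanishing of the minor makes all of these
  congruent to \<open>n 0\<close> modulo \<open>q\<close>.
\<close>

lemma fourier_minor_eq_0_imp_cong:
  assumes "CARD('p) \<noteq> CARD('q)"
    and "A \<subseteq> {0..<CARD('p)}" "B \<subseteq> {0..<CARD('p)}" "card A = card B"
    and det0: "det (submatrix (fourier_mat :: ('q::prime_card, 'p::prime_card) cyclo_ext mat) A B) = 0"
  shows "int CARD('q) dvd mult_count CARD('p) A B * int CARD('p) -
    (\<Sum>\<mu>\<in>Poly_Mapping.keys (schur_poly A). Poly_Mapping.lookup (schur_poly A) \<mu>)"
proof -
  let ?p = "CARD('p)" and ?k = "card A" and ?s = "schur_poly A"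
  let ?w = "omega :: ('q, 'p) cyclo_ext"
  define e where "e \<mu> = (\<Sum>j<card B. Poly_Mapping.lookup \<mu> j * pick B j)" for \<mu> :: "nat \<Rightarrow>\<^sub>0 nat"
  define \<phi> where "\<phi> \<mu> = ?w ^ e \<mu>" for \<mu>
  define n where "n t = (\<Sum>\<mu> | \<mu> \<in> Poly_Mapping.keys ?s \<and> e \<mu> mod ?p = t.
    Poly_Mapping.lookup ?s \<mu>)" for t
  have pickA: "pick A i < ?p" and pickB: "pick B i < ?p" if "i < ?k" for i
    using assms(2-4) that pick_in_set_le[of i A] pick_in_set_le[of i B] by auto
  have "{i. i < ?p \<and> i \<in> A} = A" "{i. i < ?p \<and> i \<in> B} = B"
    using assms(2,3) by auto
  then have sub: "submatrix (fourier_mat :: ('q, 'p) cyclo_ext mat) A B =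
      mat ?k ?k (\<lambda>(i, j). (?w ^ pick B j) ^ pick A i)"
    using assms(4) pickA pickB
    by (intro eq_matI) (auto simp: submatrix_def fourier_mat_def mult.commute simp flip: power_mult)
  let ?V = "\<Prod>j<?k. \<Prod>i<j. ?w ^ pick B j - ?w ^ pick B i"
  have minor: "det (mat ?k ?k (\<lambda>(i, j). (?w ^ pick B j) ^ pick A i)) =
      mpoly_eval \<phi> ?s * ?V"
  proof (rule alternant_eq_schur_poly_eval)
    show "\<phi> 0 = 1"
      by (simp add: \<phi>_def e_def)
    show "\<phi> (\<mu> + \<nu>) = \<phi> \<mu> * \<phi> \<nu>" for \<mu> \<nu>
      by (simp add: \<phi>_def e_def lookup_add algebra_simps sum.distrib power_add)
    show "\<phi> (Poly_Mapping.single j 1) = ?w ^ pick B j" if "j < ?k" for j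
      using that assms(4) by (simp add: \<phi>_def e_def lookup_single when_def if_distrib if_distribR
          cong: if_cong)
  qed
  have "?V dvd 1"
  proof -
    have "?w ^ pick B j - ?w ^ pick B i dvd 1" if "i < j" "j < ?k" for i j
    proof -
      have "pick B i < pick B j"
        using pick_mono_le[of j B i] that assms(4) by simp
      then have eq: "?w ^ pick B j - ?w ^ pick B i =
          ?w ^ pick B i * (?w ^ (pick B j - pick B i) - 1)"
        by (simp add: algebra_simps flip: power_add)
      have "\<not> ?p dvd pick B j - pick B i"
        using \<open>pick B i < pick B j\<close> pickB[OF that(2)] by (auto dest: dvd_imp_le)
      then have "?w ^ (pick B j - pick B i) - 1 dvd 1"
        using assms(1) by (rule omega_power_minus_1_unit[rotated])
      moreover have "?w ^ pick B i dvd 1"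
        by (metis dvd_power_same dvd_power omega_power_card power_one zero_less_card_finite)
      ultimately show ?thesis
        unfolding eq using mult_dvd_mono by fastforce
    qed
    then have "?V dvd (\<Prod>j<?k. \<Prod>i<j. 1)"
      by (intro prod_dvd_prod) auto
    then show ?thesis
      by simp
  qed
  then obtain v where v: "1 = ?V * v"
    by (rule dvdE)
  have "mpoly_eval \<phi> ?s * ?V = 0"
    using det0 unfolding sub minor .
  then have "mpoly_eval \<phi> ?s * (?V * v) = 0"
    unfolding mult.assoc[symmetric] by (simp only: mult_zero_left)
  then have "mpoly_eval \<phi> ?s = 0"
    unfolding v[symmetric] by (simp only: mult_1_right)
  moreover have "mpoly_eval \<phi> ?s = (\<Sum>t<?p. of_int (n t) * ?w ^ t)"
  proof -
    have "mpoly_eval \<phi> ?s =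
        (\<Sum>\<mu>\<in>Poly_Mapping.keys ?s. of_int (Poly_Mapping.lookup ?s \<mu>) * ?w ^ (e \<mu> mod ?p))"
      by (simp add: mpoly_eval_def \<phi>_def omega_power_mod)
    also have "\<dots> = (\<Sum>t<?p. \<Sum>\<mu> | \<mu> \<in> Poly_Mapping.keys ?s \<and> e \<mu> mod ?p = t.
        of_int (Poly_Mapping.lookup ?s \<mu>) * ?w ^ (e \<mu> mod ?p))"
      by (rule sum.group[symmetric]) auto
    also have "\<dots> = (\<Sum>t<?p. of_int (n t) * ?w ^ t)"
      by (simp add: n_def sum_distrib_right)
    finally show ?thesis .
  qed
  ultimately have n: "(of_int (n t) :: 'q mod_ring) = of_int (n 0)" if "t < ?p" for t
    using that by (intro sum_omega_power_eq_0D[where 'p = 'p]) simp_all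
  have total: "(\<Sum>t<?p. n t) =
      (\<Sum>\<mu>\<in>Poly_Mapping.keys ?s. Poly_Mapping.lookup ?s \<mu>)"
    unfolding n_def by (rule sum.group) auto
  have n0: "n 0 = mult_count ?p A B"
    by (simp add: n_def e_def mult_count_def mod_eq_0_iff_dvd)
  have "(of_int (n 0 * int ?p) :: 'q mod_ring) = (\<Sum>t<?p. of_int (n 0))"
    by simp
  also have "\<dots> = (\<Sum>t<?p. of_int (n t))"
    by (intro sum.cong refl n[symmetric]) simp
  also have "\<dots> = of_int (\<Sum>t<?p. n t)"
    by simp
  finally show ?thesis
    unfolding of_int_mod_ring_eq_iff total n0 .
qed

theorem corollary17:
  fixes p q :: nat
  assumes "p = CARD('p::prime_card)"
    and "q = CARD('q::prime_card)"
    and "p \<noteq> q"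
    and "ord p q = p - 1"
    and "real q > Max {\<bar>real_of_int (mult_count p A B) * real p - vandermonde_ratio A\<bar> | A B.
      A \<subseteq> {0..p - 1} \<and> B \<subseteq> {0..p - 1} \<and> card A = card B \<and> card A \<ge> 1}"
  shows "\<forall>I J. I \<subseteq> {0..p - 1} \<and> J \<subseteq> {0..p - 1} \<and> card I = card J \<and> card I \<ge> 1 \<longrightarrow>
    det (submatrix (fourier_mat :: ('q, 'p) cyclo_ext mat) I J) \<noteq> 0"
proof (intro allI impI notI)
  fix A B
  assume AB: "A \<subseteq> {0..p - 1} \<and> B \<subseteq> {0..p - 1} \<and> card A = card B \<and> card A \<ge> 1"
    and det0: "det (submatrix (fourier_mat :: ('q, 'p) cyclo_ext mat) A B) = 0"
  have A: "A \<subseteq> {0..p - 1}" and B: "B \<subseteq> {0..p - 1}" and card: "card A = card B" "card A \<ge> 1"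
    using AB by blast+
  have p: "prime p"
    unfolding assms(1) by (rule prime_card)
  have range: "{0..p - 1} = {0..<p}"
    using prime_gt_0_nat[OF p] by auto
  define D where "D = (\<Sum>\<mu>\<in>Poly_Mapping.keys (schur_poly A). Poly_Mapping.lookup (schur_poly A) \<mu>)"
  let ?V = "\<Prod>j<card A. \<Prod>i<j. int (pick A j) - int (pick A i)"
  let ?F = "\<Prod>j<card A. \<Prod>i<j. int j - int i"
  let ?S = "{\<bar>real_of_int (mult_count p A B) * real p - vandermonde_ratio A\<bar> | A B.
      A \<subseteq> {0..p - 1} \<and> B \<subseteq> {0..p - 1} \<and> card A = card B \<and> card A \<ge> 1}"
  have D: "D * ?F = ?V"
    unfolding D_def by (rule schur_poly_at_1)
  have ratio: "vandermonde_ratio A = real_of_int D"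
  proof -
    have "?F \<noteq> 0"
      by (simp add: prod_zero_iff)
    moreover have "vandermonde_ratio A = real_of_int ?V / real_of_int ?F"
      by (simp add: vandermonde_ratio_def)
    ultimately show ?thesis
      by (simp flip: D)
  qed
  have "finite ?S"
  proof (rule finite_subset)
    show "?S \<subseteq> (\<lambda>(A, B). \<bar>real_of_int (mult_count p A B) * real p - vandermonde_ratio A\<bar>) `
        (Pow {0..p - 1} \<times> Pow {0..p - 1})"
      by auto
  qed auto
  moreover have "\<bar>real_of_int (mult_count p A B) * real p - vandermonde_ratio A\<bar> \<in> ?S"
    using A B card by blast
  ultimately have "\<bar>real_of_int (mult_count p A B) * real p - vandermonde_ratio A\<bar> < real q"
    using assms(5) by (meson Max_ge le_less_trans)
  also have "\<bar>real_of_int (mult_count p A B) * real p - vandermonde_ratio A\<bar> =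
      real_of_int \<bar>mult_count p A B * int p - D\<bar>"
    by (simp add: ratio)
  finally have "\<bar>mult_count p A B * int p - D\<bar> < int q"
    by linarith
  moreover have "int q dvd mult_count p A B * int p - D"
    using fourier_minor_eq_0_imp_cong[of A B] A B card(1) det0 assms(1-3) range
    by (simp add: D_def)
  ultimately have "mult_count p A B * int p - D = 0"
    using dvd_imp_le_int[of "mult_count p A B * int p - D" "int q"] by linarith
  then have "D = mult_count p A B * int p"
    by simp
  then have "int p dvd D"
    by simp
  then have "int p dvd ?V"
    unfolding D[symmetric] by (rule dvd_mult2)
  moreover have "prime (int p)"
    using p by simp
  ultimately obtain j i where ij: "i < j" "j < card A" "int p dvd int (pick A j) - int (pick A i)"
    by (auto simp: prime_dvd_prod_iff)
  then have "pick A i < pick A j" "pick A j < p"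
    using pick_mono_le[of j A i] pick_in_set_le[of j A] A range by auto
  with ij(3) show False
    using zdvd_not_zless[of "int (pick A j) - int (pick A i)" "int p"] by simp
qed

end
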